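(* Let $(m_k)_{k=1}^\infty$ and $(n_k)_{k=1}^\infty$ be strictly increasing sequences of positive integers. For each $k\in\mathbb{N}$ let $\Lambda_k=2^{-m_k}\mathbb{N}\cap[n_k,n_{k+1})$ and let $\widetilde{\Lambda}=\bigcup_{k=1}^\infty\Lambda_k$. Fix $0<p<1$, put $q=1-p$, and let $\Lambda$ be chosen with probability $p$ from $\widetilde{\Lambda}$. (i) If the series $\sum_{k=1}^{\infty}\left(1-\left(1-q^{2^{m_k}}\right)^{n_{k+1}-n_k}\right)$ diverges, then almost surely $\Lambda$ is type $2$. (ii) For fixed $(m_k)$ (and $p$), if $(n_k)$ tends to infinity sufficiently fast, then almost surely $\Lambda$ is type $2$; that is, there is a sequence $(g_k)_{k=1}^{\infty}$ of positive integers, depending only on $(m_k)$ and $p$, such that almost surely $\Lambda$ is type $2$ whenever $n_k\ge g_k$ for all $k\in\mathbb{N}$.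
   Context: $\mathbb{N}=\{1,2,\dots\}$, and $2^{-m}\mathbb{N}=\{2^{-m}j: j\in\mathbb{N}\}$. Random choice: list the elements of $\widetilde{\Lambda}$ in increasing order, $\widetilde{\Lambda}=\{\lambda_1<\lambda_2<\dots\}$. Let $\Omega=\{0,1\}^{\mathbb{N}}$ with the product probability measure $\mathbb{P}$ of the measures on $\{0,1\}$ giving mass $p$ to $\{1\}$ and $1-p$ to $\{0\}$. For $\omega=(\omega_k)\in\Omega$ let $\Lambda_\omega=\{\lambda_k:\omega_k=1\}$ (each element of $\widetilde{\Lambda}$ is kept independently with probability $p$ and otherwise deleted). "$\Lambda$ is chosen with probability $p$ from $\widetilde{\Lambda}$" means $\Lambda=\Lambda_\omega$ is this random set, and a property holds almost surely if the set of those $\omega$ for which $\Lambda_\omega$ has the property has $\mathbb{P}$-measure $1$. (Almost surely $\Lambda_\omega$ is infinite.) Type: for an unbounded, infinite discrete set $\Lambda\subset[0,\infty)$ and a measurable $f:\mathbb{R}\to[0,+\infty)$ let $C(f,\Lambda)=\{x\in\mathbb{R}:\sum_{\lambda\in\Lambda}f(x+\lambda)<\infty\}$ and $D(f,\Lambda)=\{x\in\mathbb{R}:\sum_{\lambda\in\Lambda}f(x+\lambda)=\infty\}$. The set $\Lambda$ is type $1$ if for every such $f$ either $C(f,\Lambda)$ has full Lebesgue measure in $\mathbb{R}$ or $C(f,\Lambda)$ has Lebesgue measure $0$; otherwise $\Lambda$ is type $2$, i.e. there is such an $f$ for which both $C(f,\Lambda)$ and $D(f,\Lambda)$ have positive Lebesgue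 measure. *)

theory Defs
  imports "HOL-Probability.Probability"
begin

text \<open>
  Sequences are indexed from 0 here: \<open>m k\<close>, \<open>n k\<close>, \<open>\<omega> k\<close> stand for the terms usually written
  with index \<open>k + 1\<close>.
\<close>

definition dyadic_block :: "(nat \<Rightarrow> nat) \<Rightarrow> (nat \<Rightarrow> nat) \<Rightarrow> nat \<Rightarrow> real set" where
  "dyadic_block m n k = {real j / 2 ^ m k | j::nat. 0 < j} \<inter> {real (n k)..<real (n (Suc k))}"

definition dyadic_union :: "(nat \<Rightarrow> nat) \<Rightarrow> (nat \<Rightarrow> nat) \<Rightarrow> real set" where
  "dyadic_union m n = (\<Union>k. dyadic_block m n k)"

text \<open>
  The listing of \<open>S\<close> in increasing order, starting with the least element at index 0. It is
  meaningful only for sets of order type \<open>\<omega>\<close>; see \<open>ex1_increasing_enum_dyadic_union\<close> below.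
\<close>

definition increasing_enum :: "real set \<Rightarrow> nat \<Rightarrow> real" where
  "increasing_enum S = (THE e. strict_mono e \<and> range e = S)"

text \<open>The product measure on $\{0,1\}^{\mathbb{N}}$, with \<open>True\<close> for 1 and \<open>False\<close> for 0.\<close>

definition coin_measure :: "real \<Rightarrow> (nat \<Rightarrow> bool) measure" where
  "coin_measure p = (\<Pi>\<^sub>M k\<in>UNIV. measure_pmf (bernoulli_pmf p))"

definition chosen_subset :: "real set \<Rightarrow> (nat \<Rightarrow> bool) \<Rightarrow> real set" where
  "chosen_subset S \<omega> = {increasing_enum S k | k. \<omega> k}"

definition conv_set :: "(real \<Rightarrow> real) \<Rightarrow> real set \<Rightarrow> real set" where
  "conv_set f \<Lambda> = {x. (\<Sum>\<^sub>\<infinity>l\<in>\<Lambda>. ennreal (f (x + l))) < \<infinity>}"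

definition div_set :: "(real \<Rightarrow> real) \<Rightarrow> real set \<Rightarrow> real set" where
  "div_set f \<Lambda> = {x. (\<Sum>\<^sub>\<infinity>l\<in>\<Lambda>. ennreal (f (x + l))) = \<infinity>}"

text \<open>The sets to which the classification into type 1 and type 2 applies.\<close>

definition translate_set :: "real set \<Rightarrow> bool" where
  "translate_set \<Lambda> \<longleftrightarrow> \<Lambda> \<subseteq> {0..} \<and> infinite \<Lambda> \<and> \<not> bounded \<Lambda> \<and> topological_space_class.discrete \<Lambda>"

definition type1 :: "real set \<Rightarrow> bool" where
  "type1 \<Lambda> \<longleftrightarrow> translate_set \<Lambda> \<and>
     (\<forall>f \<in> borel_measurable lebesgue. (\<forall>x. 0 \<le> f x) \<longrightarrow>
        - conv_set f \<Lambda> \<in> null_sets lebesgue \<or> conv_set f \<Lambda> \<in> null_sets lebesgue)"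

definition type2 :: "real set \<Rightarrow> bool" where
  "type2 \<Lambda> \<longleftrightarrow> translate_set \<Lambda> \<and> \<not> type1 \<Lambda>"

lemma conv_set_measurable:
  assumes f: "f \<in> borel_measurable lebesgue" and \<Lambda>: "countable \<Lambda>"
  shows "conv_set f \<Lambda> \<in> sets lebesgue"
proof -
  have tr: "(\<lambda>x. f (x + l)) \<in> borel_measurable lebesgue" for l
  proof -
    have "(\<lambda>x. l + (\<Sum>j\<in>Basis. (1 * (x \<bullet> j)) *\<^sub>R j)) \<in> lebesgue \<rightarrow>\<^sub>M (lebesgue :: real measure)"
      by (rule lebesgue_affine_measurable) simp
    from measurable_compose[OF this f] show ?thesis
      by (simp add: add.commute)
  qed
  have eq: "(\<Sum>\<^sub>\<infinity>l\<in>\<Lambda>. ennreal (f (x + l))) =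
      (SUP F\<in>{F. finite F \<and> F \<subseteq> \<Lambda>}. \<Sum>l\<in>F. ennreal (f (x + l)))" for x
    by (rule nonneg_infsum_complete) simp
  have "(\<lambda>x. SUP F\<in>{F. finite F \<and> F \<subseteq> \<Lambda>}. \<Sum>l\<in>F. ennreal (f (x + l))) \<in> borel_measurable lebesgue"
    using tr by (intro borel_measurable_SUP countable_Collect_finite_subset \<Lambda>) measurable
  then have "{x \<in> space lebesgue.
      (SUP F\<in>{F. finite F \<and> F \<subseteq> \<Lambda>}. \<Sum>l\<in>F. ennreal (f (x + l))) < \<infinity>} \<in> sets lebesgue"
    by measurable
  then show ?thesis
    unfolding conv_set_def eq by simp
qed

lemma translate_set_imp_countable:
  assumes "translate_set \<Lambda>"
  shows "countable \<Lambda>"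
proof -
  obtain \<B> :: "real set set" where \<B>: "countable \<B>" "topological_basis \<B>"
    using ex_countable_basis by blast
  have "\<exists>B\<in>\<B>. B \<inter> \<Lambda> = {x}" if "x \<in> \<Lambda>" for x
  proof -
    have "x isolated_in \<Lambda>"
      using assms that by (simp add: translate_set_def discreteD)
    then obtain T where T: "open T" "T \<inter> \<Lambda> = {x}"
      by (rule isolated_inE)
    then have "x \<in> T" by blast
    obtain B where "B \<in> \<B>" "x \<in> B" "B \<subseteq> T"
      by (rule topological_basisE[OF \<B>(2) \<open>open T\<close> \<open>x \<in> T\<close>])
    then show ?thesis using T that by blast
  qed
  then have "\<Lambda> \<subseteq> (\<lambda>B. the_elem (B \<inter> \<Lambda>)) ` \<B>"
    by (intro subsetI) (metis image_eqI the_elem_eq)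
  then show ?thesis
    using \<B>(1) countable_subset by blast
qed

lemma type2_iff:
  "type2 \<Lambda> \<longleftrightarrow> translate_set \<Lambda> \<and>
     (\<exists>f \<in> borel_measurable lebesgue. (\<forall>x. 0 \<le> f x) \<and>
        0 < emeasure lebesgue (conv_set f \<Lambda>) \<and> 0 < emeasure lebesgue (div_set f \<Lambda>))"
proof (cases "translate_set \<Lambda>")
  case True
  then have c: "countable \<Lambda>"
    by (rule translate_set_imp_countable)
  have d: "div_set f \<Lambda> = - conv_set f \<Lambda>" for f
    by (auto simp: div_set_def conv_set_def simp flip: top.not_eq_extremum)
  have "conv_set f \<Lambda> \<in> null_sets lebesgue \<longleftrightarrow> \<not> 0 < emeasure lebesgue (conv_set f \<Lambda>)"
    "- conv_set f \<Lambda> \<in> null_sets lebesgue \<longleftrightarrow> \<not> 0 < emeasure lebesgue (div_set f \<Lambda>)"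
    if "f \<in> borel_measurable lebesgue" for f
    using conv_set_measurable[OF that c] sets.compl_sets[OF conv_set_measurable[OF that c]]
    by (auto simp: null_sets_def d zero_less_iff_neq_zero Compl_eq_Diff_UNIV)
  then show ?thesis
    unfolding type2_def type1_def using True by blast
qed (simp add: type2_def)

lemma ex1_increasing_enum:
  fixes S :: "real set"
  assumes inf: "infinite S" and fin: "\<And>x. finite {y\<in>S. y < x}"
  shows "\<exists>!e :: nat \<Rightarrow> real. strict_mono e \<and> range e = S"
proof -
  define r where "r x = card {y\<in>S. y < x}" for x
  have r_less: "r x < r y" if "x \<in> S" "x < y" for x y
    unfolding r_def using that by (intro psubset_card_mono fin) auto
  have inj: "inj_on r S"
    by (rule inj_onI) (metis r_less linorder_neqE less_irrefl)
  have down: "k \<in> r ` S" if k: "Suc k \<in> r ` S" for k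
  proof -
    obtain x where x: "x \<in> S" "r x = Suc k" using k by auto
    define y where "y = Max {y\<in>S. y < x}"
    have ne: "{y\<in>S. y < x} \<noteq> {}" using x unfolding r_def by (metis card.empty nat.distinct(1))
    have y: "y \<in> S" "y < x" using Max_in[OF fin ne] by (auto simp: y_def)
    have "{z\<in>S. z < x} = insert y {z\<in>S. z < y}"
      using y Max_ge[OF fin[of x]] by (fastforce simp: y_def[symmetric] order_le_less)
    then have "r x = Suc (r y)" unfolding r_def using fin[of y] by simp
    then show ?thesis using x y by auto
  qed
  have surj: "k \<in> r ` S" for k
  proof -
    have "infinite (r ` S)" using inf inj by (simp add: finite_image_iff)
    then obtain N where N: "N \<in> r ` S" "k \<le> N" by (meson infinite_nat_iff_unbounded_le)
    show ?thesis using N(2,1) by (induction rule: inc_induct) (auto intro: down)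
  qed
  define e where "e = inv_into S r"
  have eS: "e k \<in> S" and re: "r (e k) = k" for k
    unfolding e_def using surj[of k] by (auto intro: inv_into_into f_inv_into_f)
  have mono_e: "strict_mono e"
  proof (rule strict_monoI)
    fix i j :: nat
    assume "i < j"
    then show "e i < e j"
      using r_less[OF eS, of j "e i"] re[of i] re[of j] by (cases "e i" "e j" rule: linorder_cases) auto
  qed
  have "x = e (r x)" if "x \<in> S" for x
    using inj_onD[OF inj re[of "r x"] eS that] by simp
  then have range_e: "range e = S"
    using eS by blast
  have unique: "h k = e k" if h: "strict_mono h" "range h = S" for h k
  proof -
    have "{y\<in>S. y < h k} = h ` {..<k}" using h by (auto simp: strict_mono_less)
    moreover have "inj_on h {..<k}" using h(1) strict_mono_imp_inj_on inj_on_subset by blast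
    ultimately have "r (h k) = k" unfolding r_def by (simp add: card_image)
    then have "r (h k) = r (e k)" by (simp add: re)
    then show ?thesis using inj_onD[OF inj] eS h(2) by blast
  qed
  show ?thesis
  proof (rule ex1I[of _ e])
    show "strict_mono e \<and> range e = S" using mono_e range_e by blast
    show "h = e" if "strict_mono h \<and> range h = S" for h
      using unique[of h] that by (intro ext) blast
  qed
qed

lemma ex1_increasing_enum_dyadic_union:
  assumes n: "strict_mono n" and n_pos: "0 < n 0"
  shows "\<exists>!e :: nat \<Rightarrow> real. strict_mono e \<and> range e = dyadic_union m n"
proof (rule ex1_increasing_enum)
  have "real (n k) \<in> dyadic_union m n" for k
  proof -
    have "0 < n k" using n_pos n by (metis gr0I strict_mono_less not_less0)
    then have "real (n k) = real (n k * 2 ^ m k) / 2 ^ m k" "0 < n k * 2 ^ m k" by auto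
    then have "real (n k) \<in> {real j / 2 ^ m k | j::nat. 0 < j}" by blast
    moreover have "n k < n (Suc k)" using n by (simp add: strict_mono_less)
    ultimately have "real (n k) \<in> dyadic_block m n k" by (simp add: dyadic_block_def)
    then show ?thesis by (auto simp: dyadic_union_def)
  qed
  moreover have "infinite (range (\<lambda>k. real (n k)))"
    using n by (intro range_inj_infinite) (auto simp: inj_def strict_mono_eq)
  ultimately show "infinite (dyadic_union m n)"
    by (meson finite_subset image_subsetI)
next
  fix x :: real
  obtain K where K: "x < real K" using reals_Archimedean2 by blast
  have "{y \<in> dyadic_union m n. y < x} \<subseteq> (\<Union>k<K. (\<lambda>j. real j / 2 ^ m k) ` {..K * 2 ^ m k})"
  proof
    fix y assume "y \<in> {y \<in> dyadic_union m n. y < x}"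
    then obtain k j where y: "y < x" "y = real j / 2 ^ m k" "real (n k) \<le> y"
      unfolding dyadic_union_def dyadic_block_def by auto
    have "real k \<le> real (n k)" using n by (simp add: strict_mono_imp_increasing)
    then have "k < K" using y K by linarith
    moreover have "real j / 2 ^ m k \<le> real K"
      using y K by linarith
    then have "real j \<le> real (K * 2 ^ m k)"
      by (simp add: field_simps)
    then have "j \<in> {..K * 2 ^ m k}"
      by (simp only: of_nat_le_iff atMost_iff)
    ultimately show "y \<in> (\<Union>k<K. (\<lambda>j. real j / 2 ^ m k) ` {..K * 2 ^ m k})"
      using y(2) by blast
  qed
  then show "finite {y \<in> dyadic_union m n. y < x}"
    by (rule finite_subset) simp
qed

end

theory Submission
  imports Defs
begin

text \<open>
  A locally finite unbounded set \<open>\<Lambda> \<subseteq> [0, \<infinity>)\<close> that misses \<open>[j, j + 1)\<close> for infinitely many \<open>j\<close>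
  is of type 2: if \<open>T\<close> is the infinite set of those \<open>l \<in> \<Lambda>\<close> that end a gap of length at least 1,
  then the indicator function of \<open>\<Union>\<^bsub>l\<in>T\<^esub> [l - 1/2, l)\<close> has translate sums \<open>0\<close> on \<open>[0, 1/2)\<close> and
  \<open>\<infinity>\<close> on \<open>[-1/2, 0)\<close>. The unit interval \<open>[j, j + 1)\<close> inside the \<open>k\<close>-th block is deleted with
  probability \<open>q ^ 2 ^ m k\<close>, independently for different \<open>j\<close>, so by the second Borel-Cantelli lemma
  it suffices that \<open>\<Sum>k. (n (k + 1) - n k) * q ^ 2 ^ m k\<close> diverges. By Bernoulli's inequality this sum
  dominates the series of (i). If that series converges, then its terms are eventually below \<open>1/2\<close>,
  which bounds the gaps \<open>n (k + 1) - n k\<close> in terms of \<open>m k\<close> and \<open>p\<close>, so \<open>n\<close> cannot grow too fast.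
\<close>

subsection \<open>A set with infinitely many long gaps is of type 2\<close>

lemma type2_if_frequent_gaps:
  fixes \<Lambda> :: "real set"
  assumes nonneg: "\<Lambda> \<subseteq> {0..}" and inf: "infinite \<Lambda>" and fin: "\<And>x. finite {y\<in>\<Lambda>. y < x}"
    and gaps: "\<exists>\<^sub>\<infinity>j::nat. \<Lambda> \<inter> {real j..<real j + 1} = {}"
  shows "type2 \<Lambda>"
proof -
  have unbdd: "\<exists>y\<in>\<Lambda>. x \<le> y" for x
  proof (rule ccontr)
    assume "\<not> ?thesis"
    then have "\<Lambda> \<subseteq> {y\<in>\<Lambda>. y < x}" by force
    then show False using fin[of x] inf finite_subset by blast
  qed
  have "\<not> bounded \<Lambda>"
  proof
    assume "bounded \<Lambda>"
    then obtain B where B: "\<And>y. y \<in> \<Lambda> \<Longrightarrow> \<bar>y\<bar> \<le> B" by (auto simp: bounded_iff)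
    obtain y where "y \<in> \<Lambda>" "B + 1 \<le> y" using unbdd by blast
    then show False using B[of y] by linarith
  qed
  moreover have "topological_space_class.discrete \<Lambda>"
  proof (rule discreteI)
    fix x assume x: "x \<in> \<Lambda>"
    \<comment> \<open>Only finitely many points of \<open>\<Lambda>\<close> lie below
      \<open>x + 1\<close>, so removing all of them except \<open>x\<close> from the open ray keeps
      it open.\<close>
    let ?T = "{..<x + 1} - ({y\<in>\<Lambda>. y < x + 1} - {x})"
    have "open ?T" using fin by (intro open_Diff finite_imp_closed) auto
    moreover have "?T \<inter> \<Lambda> = {x}" using x by auto
    ultimately show "x isolated_in \<Lambda>" using x by (intro isolated_inI)
  qed
  ultimately have tr: "translate_set \<Lambda>"
    using nonneg inf by (simp add: translate_set_def)
  define T where "T = {l\<in>\<Lambda>. \<Lambda> \<inter> {l - 1..<l} = {}}"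
  have T_unbdd: "\<exists>l\<in>T. x \<le> l" for x
  proof -
    obtain j :: nat where j: "\<Lambda> \<inter> {real j..<real j + 1} = {}" "x \<le> real j"
    proof -
      obtain N :: nat where "x \<le> real N" using real_arch_simple by blast
      moreover obtain j where "N \<le> j" "\<Lambda> \<inter> {real j..<real j + 1} = {}"
        using gaps unfolding INFM_nat_le by blast
      ultimately show ?thesis using that by force
    qed
    obtain z where z: "z \<in> \<Lambda>" "real j \<le> z" using unbdd by blast
    \<comment> \<open>The first point of \<open>\<Lambda>\<close> from \<open>j\<close> on ends a
      gap of length 1, because \<open>[j, j + 1)\<close> is empty. Cutting off at
      \<open>z + 1\<close> makes the candidates a finite set that still contains \<open>z\<close>,
      so \<open>Min\<close> is meaningful.\<close>
    define F where "F = {y\<in>\<Lambda>. real j \<le> y \<and> y < z + 1}"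
    have F: "finite F" "F \<noteq> {}"
      using z finite_subset[of F, OF _ fin[of "z + 1"]] by (auto simp: F_def)
    define l where "l = Min F"
    have l: "l \<in> \<Lambda>" "real j \<le> l" "l < z + 1" using Min_in[OF F] by (auto simp: l_def F_def)
    have least: "l \<le> y" if "y \<in> \<Lambda>" "real j \<le> y" for y
    proof (cases "y < z + 1")
      case True
      then show ?thesis using that F(1) by (auto simp: l_def F_def)
    qed (use l in linarith)
    have "real j + 1 \<le> l" using j(1) l by force
    then have "\<Lambda> \<inter> {l - 1..<l} = {}" using least by fastforce
    then show ?thesis using l j(2) by (auto simp: T_def intro!: bexI[of _ l])
  qed
  have T_inf: "infinite T"
  proof
    assume "finite T"
    obtain l where "l \<in> T" "Max T + 1 \<le> l" using T_unbdd by blast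
    then show False using Max_ge[OF \<open>finite T\<close>, of l] by linarith
  qed
  have "countable T"
    using translate_set_imp_countable[OF tr] countable_subset[of T \<Lambda>] by (auto simp: T_def)
  define f where "f = (indicator (\<Union>l\<in>T. {l - 1/2..<l}) :: real \<Rightarrow> real)"
  have "f \<in> borel_measurable borel"
    unfolding f_def using \<open>countable T\<close> by (intro borel_measurable_indicator sets.countable_UN') auto
  then have meas: "f \<in> borel_measurable lebesgue"
    by (simp add: measurable_completion)
  have "{0..<1/2} \<subseteq> conv_set f \<Lambda>"
  proof
    fix x :: real assume x: "x \<in> {0..<1/2}"
    have "f (x + l) = 0" if l: "l \<in> \<Lambda>" for l
    proof -
      \<comment> \<open>A shift by \<open>x\<close> in \<open>[0, 1/2)\<close> could only reach
        \<open>[t - 1/2, t)\<close> from \<open>[t - 1, t)\<close>, the gap before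
        \<open>t\<close>.\<close>
      have "x + l \<notin> {t - 1/2..<t}" if t: "t \<in> T" for t
      proof
        assume "x + l \<in> {t - 1/2..<t}"
        then have "l \<in> \<Lambda> \<inter> {t - 1..<t}" using x l by auto
        then show False using t by (auto simp: T_def)
      qed
      then show ?thesis by (simp add: f_def)
    qed
    then have "(\<Sum>\<^sub>\<infinity>l\<in>\<Lambda>. ennreal (f (x + l))) = 0" by (intro infsum_0) simp
    then show "x \<in> conv_set f \<Lambda>" by (simp add: conv_set_def)
  qed
  moreover have "{-1/2..<0} \<subseteq> div_set f \<Lambda>"
  proof
    fix x :: real assume x: "x \<in> {-1/2..<0}"
    have "f (x + l) = 1" if "l \<in> T" for l
      using x that by (force simp: f_def indicator_def)
    \<comment> \<open>Every \<open>l\<close> in the infinite set \<open>T\<close> contributes a term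
      1.\<close>
    then have "\<infinity> = (\<Sum>\<^sub>\<infinity>l\<in>T. ennreal (f (x + l)))"
      using T_inf by (intro infsum_superconst_infinite_ennreal[of T 1, symmetric]) auto
    also have "\<dots> \<le> (\<Sum>\<^sub>\<infinity>l\<in>\<Lambda>. ennreal (f (x + l)))"
      by (intro infsum_mono_neutral nonneg_summable_on_complete) (auto simp: T_def)
    finally show "x \<in> div_set f \<Lambda>" by (simp add: div_set_def top_unique)
  qed
  moreover have "conv_set f \<Lambda> \<in> sets lebesgue" "div_set f \<Lambda> \<in> sets lebesgue"
  proof -
    show C: "conv_set f \<Lambda> \<in> sets lebesgue"
      by (rule conv_set_measurable[OF meas translate_set_imp_countable[OF tr]])
    have "div_set f \<Lambda> = space lebesgue - conv_set f \<Lambda>"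
      by (auto simp: div_set_def conv_set_def simp flip: top.not_eq_extremum)
    then show "div_set f \<Lambda> \<in> sets lebesgue" using sets.compl_sets[OF C] by (simp only:)
  qed
  ultimately have "emeasure lebesgue {0..<1/2::real} \<le> emeasure lebesgue (conv_set f \<Lambda>)"
    "emeasure lebesgue {-1/2..<0::real} \<le> emeasure lebesgue (div_set f \<Lambda>)"
    by (intro emeasure_mono; simp)+
  then have "0 < emeasure lebesgue (conv_set f \<Lambda>)" "0 < emeasure lebesgue (div_set f \<Lambda>)"
    by (auto elim!: less_le_trans[rotated] simp: ennreal_inverse_positive)
  moreover have "\<forall>x. 0 \<le> f x" by (simp add: f_def)
  ultimately show ?thesis
    unfolding type2_iff using tr meas by blast
qed

subsection \<open>The second Borel-Cantelli lemma and independent blocks of coordinates\<close>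

text \<open>By \<open>1 - t \<le> exp (- t)\<close>, independence bounds the probability that no
  \<open>A j\<close> with \<open>j\<close> in a finite range occurs by \<open>exp\<close> of minus
  the sum of their probabilities. Divergence makes this arbitrarily small beyond any
  \<open>N\<close>.\<close>

lemma (in prob_space) borel_cantelli2:
  fixes A :: "nat \<Rightarrow> 'a set"
  assumes ind: "indep_events A UNIV" and div: "\<not> summable (\<lambda>j. prob (A j))"
  shows "AE x in M. \<exists>\<^sub>\<infinity>j. x \<in> A j"
proof -
  have A: "A j \<in> events" for j
    using ind by (auto simp: indep_events_def)
  have indep_compl: "prob (\<Inter>j\<in>J. space M - A j) = (\<Prod>j\<in>J. 1 - prob (A j))"
    if J: "finite J" "J \<noteq> {}" for J
  proof -
    \<comment> \<open>Independence passes to complements through the generated sigma-algebras; a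
      single event is trivially an intersection-stable generator.\<close>
    have "indep_sets (\<lambda>j. sigma_sets (space M) {A j}) UNIV"
      using ind by (intro indep_sets_sigma) (auto simp: indep_events_def_alt Int_stable_def)
    then have "prob (\<Inter>j\<in>J. space M - A j) = (\<Prod>j\<in>J. prob (space M - A j))"
      using J by (intro indep_setsD) (auto intro: sigma_sets.intros)
    then show ?thesis using A by (simp add: prob_compl)
  qed
  have null: "(\<Inter>j\<in>{N..}. space M - A j) \<in> null_sets M" (is "?B \<in> _") for N
  proof -
    have B: "?B \<in> events"
      using A by (intro sets.countable_INT') auto
    have "prob ?B \<le> \<epsilon>" if "0 < \<epsilon>" for \<epsilon>
    proof -
      have "\<not> summable (\<lambda>j. prob (A (j + N)))"
        using div summable_iff_shift[of "\<lambda>j. prob (A j)" N] by simp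
      then obtain K where K: "- ln \<epsilon> < (\<Sum>j<K. prob (A (j + N)))"
        using summableI_nonneg_bounded[of "\<lambda>j. prob (A (j + N))" "- ln \<epsilon>"]
        by (meson measure_nonneg not_le)
      \<comment> \<open>The range is extended to \<open>Suc K\<close> indices so that it is nonempty
        even for \<open>K = 0\<close>, as \<open>indep_compl\<close> demands.\<close>
      have K': "(\<Sum>j<K. prob (A (j + N))) \<le> (\<Sum>j\<in>{N..<N + Suc K}. prob (A j))"
      proof -
        have "(\<Sum>j<K. prob (A (j + N))) = (\<Sum>j\<in>{N..<N + K}. prob (A j))"
          using sum.shift_bounds_nat_ivl[of "\<lambda>j. prob (A j)" 0 N K]
          by (simp add: atLeast0LessThan add.commute)
        then show ?thesis by (simp add: add_nonneg_nonneg)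
      qed
      have "prob ?B \<le> prob (\<Inter>j\<in>{N..<N + Suc K}. space M - A j)"
        using A by (intro finite_measure_mono INF_superset_mono sets.finite_INT) auto
      also have "\<dots> = (\<Prod>j\<in>{N..<N + Suc K}. 1 - prob (A j))"
        by (intro indep_compl) auto
      also have "\<dots> \<le> (\<Prod>j\<in>{N..<N + Suc K}. exp (- prob (A j)))"
        using exp_ge_add_one_self[of "- prob (A _)"] by (intro prod_mono) auto
      also have "\<dots> = exp (- (\<Sum>j\<in>{N..<N + Suc K}. prob (A j)))"
        by (simp only: exp_sum[symmetric] sum_negf finite_atLeastLessThan)
      also have "\<dots> \<le> exp (ln \<epsilon>)"
        using K K' by (intro exp_mono) linarith
      finally show ?thesis using \<open>0 < \<epsilon>\<close> by simp
    qed
    then have "prob ?B = 0"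
      by (meson antisym dense_ge measure_nonneg)
    then show ?thesis using B by (simp add: null_sets_def emeasure_eq_measure)
  qed
  have "AE x in M. \<forall>N. x \<notin> (\<Inter>j\<in>{N..}. space M - A j)"
    unfolding AE_all_countable using AE_not_in[OF null] by blast
  then show ?thesis
    by (rule AE_mp) (auto intro!: AE_I2 simp: INFM_nat_le)
qed

text \<open>Restrictions to disjoint blocks of coordinates are independent, so the second
  Borel-Cantelli lemma applies. It serves twice: with \<open>b = False\<close> for the gaps, and
  with \<open>b = True\<close> and singleton blocks for the infinitude of the chosen set.\<close>

lemma AE_PiM_pmf_infinitely_often_constant:
  fixes D :: "'a pmf" and K :: "nat \<Rightarrow> 'i set"
  assumes disj: "disjoint_family K" and fin: "\<And>j. finite (K j)"
    and div: "\<not> summable (\<lambda>j. pmf D b ^ card (K j))"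
  shows "AE \<omega> in (\<Pi>\<^sub>M i\<in>UNIV. measure_pmf D). \<exists>\<^sub>\<infinity>j. \<forall>i\<in>K j. \<omega> i = b"
proof -
  let ?M = "\<Pi>\<^sub>M i\<in>(UNIV :: 'i set). measure_pmf D"
  interpret product_prob_space "\<lambda>_. measure_pmf D" "UNIV :: 'i set" ..
  have space: "space ?M = UNIV" by (simp add: space_PiM)
  have coord: "P.indep_vars (\<lambda>_. measure_pmf D) (\<lambda>i \<omega>. \<omega> i) UNIV"
    by (subst P.indep_vars_iff_distr_eq_PiM') (auto simp: PiM_component restrict_UNIV distr_id)
  define A where "A j = {\<omega>. \<forall>i\<in>K j. \<omega> i = b}" for j
  have "P.indep_vars (\<lambda>j. PiM (K j) (\<lambda>_. measure_pmf D)) (\<lambda>j \<omega>. restrict \<omega> (K j)) UNIV"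
    using P.indep_vars_restrict[OF coord, of UNIV K] disj by simp
  then have "P.indep_events (\<lambda>j. {\<omega>\<in>space ?M. \<forall>i\<in>K j. restrict \<omega> (K j) i = b}) UNIV"
    by (rule P.indep_eventsI_indep_vars) (use fin in measurable)
  then have "P.indep_events A UNIV"
    by (simp add: space A_def[abs_def] cong: ball_cong)
  \<comment> \<open>Empty blocks do occur, for instance for unit intervals below \<open>n 0\<close>;
    their event is certain, in accordance with the zeroth power.\<close>
  moreover have "P.prob (A j) = pmf D b ^ card (K j)" for j
  proof (cases "K j = {}")
    case True
    then show ?thesis using P.prob_space by (simp add: A_def space)
  next
    case False
    have "A j = (\<Inter>i\<in>K j. (\<lambda>\<omega>. \<omega> i) -` {b} \<inter> space ?M)"
      using False by (auto simp: A_def space)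
    then have "P.prob (A j) = (\<Prod>i\<in>K j. P.prob ((\<lambda>\<omega>. \<omega> i) -` {b} \<inter> space ?M))"
      using P.indep_varsD[OF coord, of "K j" "\<lambda>_. {b}"] False fin by simp
    moreover have "P.prob ((\<lambda>\<omega>. \<omega> i) -` {b} \<inter> space ?M) = pmf D b" for i
      using measure_distr[of "\<lambda>\<omega>. \<omega> i" ?M "measure_pmf D" "{b}"] PiM_component[of i]
      by (simp add: measure_pmf_single)
    ultimately show ?thesis by simp
  qed
  ultimately have "AE \<omega> in ?M. \<exists>\<^sub>\<infinity>j. \<omega> \<in> A j"
    using div by (intro P.borel_cantelli2) auto
  then show ?thesis by (simp add: A_def)
qed

subsection \<open>Random subsets of the union of the dyadic blocks\<close>

lemma dyadic_union_subset_nonneg: "dyadic_union m n \<subseteq> {0..}"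
  by (auto simp: dyadic_union_def dyadic_block_def)

text \<open>Block endpoints are integers, so only block \<open>k\<close> meets
  \<open>[j, j + 1)\<close>, and its points there have numerators in a range of
  \<open>2 ^ m k\<close> integers.\<close>

lemma card_dyadic_union_unit_interval_le:
  assumes n: "strict_mono n" and j: "n k \<le> j" "j < n (Suc k)"
  shows "finite (dyadic_union m n \<inter> {real j..<real j + 1})"
    and "card (dyadic_union m n \<inter> {real j..<real j + 1}) \<le> 2 ^ m k"
proof -
  let ?I = "{j * 2 ^ m k..<(j + 1) * 2 ^ m k}"
  have sub: "dyadic_union m n \<inter> {real j..<real j + 1} \<subseteq> (\<lambda>i. real i / 2 ^ m k) ` ?I"
  proof
    fix y assume y: "y \<in> dyadic_union m n \<inter> {real j..<real j + 1}"
    then obtain k' i where y': "y = real i / 2 ^ m k'" "real (n k') \<le> y" "y < real (n (Suc k'))"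
      by (auto simp: dyadic_union_def dyadic_block_def)
    have "real (n k') < real j + 1" "real j < real (n (Suc k'))"
      using y y' by auto
    then have *: "n k' \<le> j" "j < n (Suc k')" by linarith+
    have "k' = k"
    proof (rule ccontr)
      assume "k' \<noteq> k"
      then consider "Suc k' \<le> k" | "Suc k \<le> k'" by linarith
      then show False
        using * j n by cases (meson leD le_trans strict_mono_less_eq)+
    qed
    then have yk: "y = real i / 2 ^ m k" using y' by simp
    then have "real j * 2 ^ m k \<le> real i" "real i < (real j + 1) * 2 ^ m k"
      using y by (auto simp: pos_le_divide_eq pos_divide_less_eq)
    then have "real (j * 2 ^ m k) \<le> real i" "real i < real ((j + 1) * 2 ^ m k)"
      by (simp_all add: algebra_simps)
    then have "i \<in> ?I" by (simp only: of_nat_le_iff of_nat_less_iff atLeastLessThan_iff)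
    then show "y \<in> (\<lambda>i. real i / 2 ^ m k) ` ?I" using yk by blast
  qed
  then show "finite (dyadic_union m n \<inter> {real j..<real j + 1})"
    by (rule finite_subset) simp
  have "card (dyadic_union m n \<inter> {real j..<real j + 1}) \<le> card ?I"
    using sub by (rule surj_card_le[rotated]) simp
  then show "card (dyadic_union m n \<inter> {real j..<real j + 1}) \<le> 2 ^ m k" by simp
qed

lemma strict_mono_imp_ex_block:
  fixes n :: "nat \<Rightarrow> nat"
  assumes "strict_mono n" "n 0 \<le> j"
  obtains k where "n k \<le> j" "j < n (Suc k)"
proof -
  have "\<exists>k. j < n k"
    using strict_mono_imp_increasing[OF assms(1), of "Suc j"] by (meson Suc_le_lessD)
  \<comment> \<open>This least index is positive because \<open>n 0 \<le> j\<close>; its predecessor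
    is the block sought.\<close>
  define k where "k = (LEAST k. j < n k)"
  have k: "j < n k" unfolding k_def using \<open>\<exists>k. j < n k\<close> by (rule LeastI_ex)
  then obtain k' where k': "k = Suc k'" using assms(2) by (cases k) auto
  then have "n k' \<le> j" using not_less_Least[of k' "\<lambda>k. j < n k"] by (simp add: k_def[symmetric] not_less)
  then show ?thesis using that k k' by blast
qed

lemma finite_dyadic_union_less:
  assumes n: "strict_mono n"
  shows "finite {y \<in> dyadic_union m n. y < x}"
proof -
  let ?S = "dyadic_union m n"
  have fin: "finite (?S \<inter> {real j..<real j + 1})" for j
  proof (cases "n 0 \<le> j")
    case True
    then show ?thesis
      using strict_mono_imp_ex_block[OF n] card_dyadic_union_unit_interval_le(1)[OF n] by metis
  next
    case False
    have "real (n 0) \<le> y" if "y \<in> ?S" for y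
    proof -
      obtain k where "real (n k) \<le> y" using \<open>y \<in> ?S\<close> by (auto simp: dyadic_union_def dyadic_block_def)
      moreover have "n 0 \<le> n k" using n by (simp add: strict_mono_less_eq)
      ultimately show ?thesis by linarith
    qed
    then have "?S \<inter> {real j..<real j + 1} = {}" using False by fastforce
    then show ?thesis by simp
  qed
  obtain N :: nat where "x \<le> real N" using real_arch_simple by blast
  have "{y\<in>?S. y < x} \<subseteq> (\<Union>j<N. ?S \<inter> {real j..<real j + 1})"
  proof
    fix y assume y: "y \<in> {y\<in>?S. y < x}"
    then have "0 \<le> y" using dyadic_union_subset_nonneg by auto
    then have "real (nat \<lfloor>y\<rfloor>) \<le> y" "y < real (nat \<lfloor>y\<rfloor>) + 1" by linarith+
    moreover from this have "nat \<lfloor>y\<rfloor> < N" using y \<open>x \<le> real N\<close> by auto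
    ultimately show "y \<in> (\<Union>j<N. ?S \<inter> {real j..<real j + 1})" using y by auto
  qed
  then show ?thesis by (rule finite_subset) (use fin in blast)
qed

lemma AE_type2_if_not_summable:
  fixes m n :: "nat \<Rightarrow> nat"
  assumes p: "0 < p" "p < 1" "q = 1 - p" and n: "strict_mono n" "0 < n 0"
    and div: "\<not> summable (\<lambda>k. 1 - (1 - q ^ (2 ^ m k)) ^ (n (Suc k) - n k))"
  shows "AE \<omega> in coin_measure p. type2 (chosen_subset (dyadic_union m n) \<omega>)"
proof -
  let ?S = "dyadic_union m n" and ?r = "\<lambda>k. q ^ (2 ^ m k)"
  define e where "e = increasing_enum ?S"
  have e: "strict_mono e" "range e = ?S"
    using theI'[OF ex1_increasing_enum_dyadic_union[OF n, of m]]
    unfolding e_def increasing_enum_def by blast+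
  have inj: "inj e" using e(1) by (rule strict_mono_imp_inj_on)
  have S_fin: "finite {y\<in>?S. y < x}" for x by (rule finite_dyadic_union_less[OF n(1)])
  have q: "0 < q" "q < 1" using p by auto
  have pmf: "pmf (bernoulli_pmf p) False = q" "pmf (bernoulli_pmf p) True = p" using p by auto
  have sub: "chosen_subset ?S \<omega> \<subseteq> ?S" for \<omega>
    using e(2) by (auto simp: chosen_subset_def e_def[symmetric])
  \<comment> \<open>These are the coins deciding the points of \<open>[j, j + 1)\<close>; the
    interval becomes a gap when all of them show \<open>False\<close>.\<close>
  define K where "K j = e -` {real j..<real j + 1}" for j
  have card_K: "card (K j) = card (?S \<inter> {real j..<real j + 1})" for j
  proof -
    have "K j = e -` (?S \<inter> {real j..<real j + 1})" using e(2) by (auto simp: K_def)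
    then show ?thesis using card_vimage_inj[OF inj, of "?S \<inter> {real j..<real j + 1}"] e(2) by (simp only: inf_le1)
  qed
  have "AE \<omega> in coin_measure p. \<exists>\<^sub>\<infinity>j. \<forall>i\<in>K j. \<omega> i = False"
    unfolding coin_measure_def
  proof (rule AE_PiM_pmf_infinitely_often_constant)
    show "disjoint_family K"
    proof (unfold disjoint_family_on_def, intro ballI impI)
      fix i j :: nat assume "i \<noteq> j"
      then consider "real i + 1 \<le> real j" | "real j + 1 \<le> real i" by linarith
      then show "K i \<inter> K j = {}" by cases (auto simp: K_def)
    qed
    show "finite (K j)" for j
    proof -
      have "K j \<subseteq> e -` {y\<in>?S. y < real j + 1}" using e(2) by (auto simp: K_def)
      then show ?thesis using finite_vimageI[OF S_fin inj] finite_subset by blast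
    qed
    show "\<not> summable (\<lambda>j. pmf (bernoulli_pmf p) False ^ card (K j))"
    proof
      assume "summable (\<lambda>j. pmf (bernoulli_pmf p) False ^ card (K j))"
      then have summ: "summable (\<lambda>j. q ^ card (K j))" by (simp only: pmf)
      \<comment> \<open>Bernoulli's inequality bounds the term by the number of unit intervals in
        block \<open>k\<close> times \<open>q ^ 2 ^ m k\<close>. Each such interval has at most
        \<open>2 ^ m k\<close> points, and \<open>q < 1\<close>.\<close>
      have block_term: "1 - (1 - ?r k) ^ (n (Suc k) - n k) \<le> (\<Sum>j\<in>{n k..<n (Suc k)}. q ^ card (K j))" for k
      proof -
        have "1 + real (n (Suc k) - n k) * (- ?r k) \<le> (1 + (- ?r k)) ^ (n (Suc k) - n k)"
          using q by (intro Bernoulli_inequality) (simp add: power_le_one)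
        then have "1 - (1 - ?r k) ^ (n (Suc k) - n k) \<le> real (n (Suc k) - n k) * ?r k" by simp
        also have "\<dots> = (\<Sum>j\<in>{n k..<n (Suc k)}. ?r k)" by simp
        also have "\<dots> \<le> (\<Sum>j\<in>{n k..<n (Suc k)}. q ^ card (K j))"
          using q card_dyadic_union_unit_interval_le[OF n(1), of k _ m]
          by (intro sum_mono power_decreasing) (auto simp: card_K)
        finally show ?thesis .
      qed
      \<comment> \<open>The blocks tile the integers from \<open>n 0\<close> on, so the block sums
        join into one sum over \<open>j\<close>.\<close>
      have blocks: "(\<Sum>k<N. \<Sum>j\<in>{n k..<n (Suc k)}. g j) = (\<Sum>j\<in>{n 0..<n N}. g j)"
        for N and g :: "nat \<Rightarrow> real"
      proof (induction N)
        case (Suc N)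
        then show ?case
          using n(1) by (simp add: sum.atLeastLessThan_concat strict_mono_less_eq)
      qed simp
      have "summable (\<lambda>k. 1 - (1 - ?r k) ^ (n (Suc k) - n k))"
      proof (rule summableI_nonneg_bounded)
        show "0 \<le> 1 - (1 - ?r k) ^ (n (Suc k) - n k)" for k
          using q by (simp add: power_le_one)
        show "(\<Sum>k<N. 1 - (1 - ?r k) ^ (n (Suc k) - n k)) \<le> (\<Sum>j. q ^ card (K j))" for N
        proof -
          have "(\<Sum>k<N. 1 - (1 - ?r k) ^ (n (Suc k) - n k)) \<le> (\<Sum>j\<in>{n 0..<n N}. q ^ card (K j))"
            unfolding blocks[symmetric] by (intro sum_mono block_term)
          also have "\<dots> \<le> (\<Sum>j. q ^ card (K j))"
            using q by (intro sum_le_suminf summ) auto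
          finally show ?thesis .
        qed
      qed
      then show False using div by blast
    qed
  qed
  moreover have "AE \<omega> in coin_measure p. \<exists>\<^sub>\<infinity>j. \<forall>i\<in>{j}. \<omega> i = True"
    unfolding coin_measure_def
    by (rule AE_PiM_pmf_infinitely_often_constant)
      (use p in \<open>auto simp: disjoint_family_on_def summable_const_iff\<close>)
  ultimately show ?thesis
  proof eventually_elim
    case (elim \<omega>)
    let ?L = "chosen_subset ?S \<omega>"
    have L: "?L = e ` {k. \<omega> k}" by (auto simp: chosen_subset_def e_def)
    show ?case
    proof (rule type2_if_frequent_gaps)
      show "?L \<subseteq> {0..}" using sub dyadic_union_subset_nonneg by blast
      have "infinite {k. \<omega> k}" using elim(2) by (simp add: frequently_cofinite)
      then show "infinite ?L" unfolding L using inj finite_imageD inj_on_subset by blast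
      show "finite {y\<in>?L. y < x}" for x
        by (rule finite_subset[OF _ S_fin[of x]]) (use sub in blast)
      show "\<exists>\<^sub>\<infinity>j. ?L \<inter> {real j..<real j + 1} = {}"
        using elim(1) by (rule frequently_elim1) (auto simp: L K_def)
    qed
  qed
qed

text \<open>Summability would force the terms below \<open>1/2\<close>, hence the gaps of
  \<open>n\<close> below some \<open>c k\<close> determined by \<open>r k\<close>, from some
  \<open>K\<close> on. A \<open>g\<close> outgrowing the partial sums of \<open>c\<close> by an
  unbounded amount excludes this for every starting value \<open>n K\<close>.\<close>

lemma ex_growth_bound_not_summable:
  fixes r :: "nat \<Rightarrow> real"
  assumes r: "\<And>k. 0 < r k" "\<And>k. r k \<le> 1"
  shows "\<exists>g :: nat \<Rightarrow> nat. (\<forall>k. 0 < g k) \<and>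
    (\<forall>n :: nat \<Rightarrow> nat. strict_mono n \<longrightarrow> (\<forall>k. g k \<le> n k) \<longrightarrow>
       \<not> summable (\<lambda>k. 1 - (1 - r k) ^ (n (Suc k) - n k)))"
proof -
  have "\<exists>c. (1 - r k) ^ c < 1/2" for k
    using r[of k] by (intro real_arch_pow_inv) auto
  then obtain c where c: "\<And>k. (1 - r k) ^ c k < 1/2" by metis
  define g where "g K = Suc K + (\<Sum>k<K. c k)" for K
  have "\<not> summable (\<lambda>k. 1 - (1 - r k) ^ (n (Suc k) - n k))"
    if n: "strict_mono n" "\<forall>k. g k \<le> n k" for n
  proof
    assume "summable (\<lambda>k. 1 - (1 - r k) ^ (n (Suc k) - n k))"
    then have "(\<lambda>k. 1 - (1 - r k) ^ (n (Suc k) - n k)) \<longlonglongrightarrow> 0" by (rule summable_LIMSEQ_zero)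
    then have "\<forall>\<^sub>F k in sequentially. 1 - (1 - r k) ^ (n (Suc k) - n k) < 1/2"
      by (rule order_tendstoD) simp
    then obtain K where K: "\<And>k. K \<le> k \<Longrightarrow> 1 - (1 - r k) ^ (n (Suc k) - n k) < 1/2"
      by (auto simp: eventually_sequentially)
    have gap: "n (Suc k) \<le> n k + c k" if "K \<le> k" for k
    proof (rule ccontr)
      assume "\<not> ?thesis"
      then have "(1 - r k) ^ (n (Suc k) - n k) \<le> (1 - r k) ^ c k"
        using r[of k] by (intro power_decreasing) auto
      then show False using c[of k] K[OF that] by simp
    qed
    have bound: "n (K + d) \<le> n K + (\<Sum>k<K + d. c k)" for d
    proof (induction d)
      case (Suc d)
      then show ?case using gap[of "K + d"] by simp
    qed simp
    \<comment> \<open>At this index the summand \<open>Suc (K + n K)\<close> of \<open>g\<close>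
      exceeds \<open>n K\<close>, the only part of the upper bound besides the sum of
      \<open>c\<close>.\<close>
    have "g (K + n K) \<le> n (K + n K)" using n by blast
    then show False using bound[of "n K"] by (simp add: g_def)
  qed
  then show ?thesis by (intro exI[of _ g]) (auto simp: g_def)
qed

theorem theorem4p5:
  fixes m :: "nat \<Rightarrow> nat" and p q :: real
  assumes "strict_mono m" and "\<forall>k. 0 < m k"
    and "0 < p" and "p < 1" and "q = 1 - p"
  shows "(\<forall>n :: nat \<Rightarrow> nat. strict_mono n \<longrightarrow> (\<forall>k. 0 < n k) \<longrightarrow>
            \<not> summable (\<lambda>k. 1 - (1 - q ^ (2 ^ m k)) ^ (n (Suc k) - n k)) \<longrightarrow>
            (AE \<omega> in coin_measure p. type2 (chosen_subset (dyadic_union m n) \<omega>)))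
       \<and> (\<exists>g :: nat \<Rightarrow> nat. (\<forall>k. 0 < g k) \<and>
            (\<forall>n :: nat \<Rightarrow> nat. strict_mono n \<longrightarrow> (\<forall>k. 0 < n k) \<longrightarrow> (\<forall>k. g k \<le> n k) \<longrightarrow>
              (AE \<omega> in coin_measure p. type2 (chosen_subset (dyadic_union m n) \<omega>))))"
proof -
  have main: "AE \<omega> in coin_measure p. type2 (chosen_subset (dyadic_union m n) \<omega>)"
    if "strict_mono n" "\<forall>k. 0 < n k"
      "\<not> summable (\<lambda>k. 1 - (1 - q ^ (2 ^ m k)) ^ (n (Suc k) - n k))" for n
    using that assms by (intro AE_type2_if_not_summable) auto
  have "0 < q ^ (2 ^ m k)" "q ^ (2 ^ m k) \<le> 1" for k
    using assms by (auto intro: power_le_one)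
  \<comment> \<open>Here \<open>r k\<close> is \<open>q ^ 2 ^ m k\<close>, which does not involve
    \<open>n\<close>; hence one \<open>g\<close> serves all sequences \<open>n\<close>.\<close>
  then obtain g :: "nat \<Rightarrow> nat" where "\<forall>k. 0 < g k"
    "\<And>n. strict_mono n \<Longrightarrow> \<forall>k. g k \<le> n k \<Longrightarrow>
      \<not> summable (\<lambda>k. 1 - (1 - q ^ (2 ^ m k)) ^ (n (Suc k) - n k))"
    using ex_growth_bound_not_summable[of "\<lambda>k. q ^ (2 ^ m k)"] by blast
  then show ?thesis
    using main by blast
qed

end
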